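(* For any weak composition $\mathbf{a}=(a_1,\dots,a_n)$, the Kohnert poset $\mathcal{P}(\mathbb{D}(\mathbf{a}))$ is bounded.
   Context: A diagram is a finite set $D$ of cells $(r,c)$ with $r,c$ positive integers; $r$ is the row (rows numbered from bottom to top starting at 1) and $c$ the column (numbered from left to right starting at 1). A Kohnert move at row $r$ applied to a diagram $D$: if row $r$ of $D$ is empty, $D$ is unchanged; otherwise let $(r,c)$ be the cell of row $r$ with the largest column index; if every position $(r',c)$ with $1\le r'<r$ belongs to $D$, then $D$ is unchanged; otherwise let $r'$ be the largest integer with $1\le r'<r$ and $(r',c)\notin D$, and the move replaces the cell $(r,c)$ by $(r',c)$. For a diagram $D_0$, $KD(D_0)$ is the set of all diagrams obtainable from $D_0$ by finite (possibly empty) sequences of Kohnert moves; the Kohnert poset $\mathcal{P}(D_0)$ is $KD(D_0)$ ordered by $D_2\preceq D_1$ iff $D_2$ can be obtained from $D_1$ by a finite sequence of Kohnert moves. A finite poset is bounded if it has a unique minimal element and a unique maximal element. For a weak composition $\mathbf{a}=(a_1,\dots,a_n)\in\mathbb{Z}_{\ge0}^n$, the key diagram is $\mathbb{D}(\mathbf{a})=\bigcup_{i=1}^n\{(i,j):1\le j\le a_i\}$. *)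

theory Defs
  imports Main
begin

text \<open>Cells are pairs (row, column); rows and columns are numbered from 1,
  rows from bottom to top.\<close>

type_synonym cell = "nat \<times> nat"

definition is_diagram :: "cell set \<Rightarrow> bool" where
  "is_diagram D \<longleftrightarrow> finite D \<and> (\<forall>(r, c) \<in> D. 1 \<le> r \<and> 1 \<le> c)"

definition kohnert_move :: "nat \<Rightarrow> cell set \<Rightarrow> cell set" where
  "kohnert_move r D =
     (if {c. (r, c) \<in> D} = {} then D
      else let c = Max {c. (r, c) \<in> D} in
        if \<forall>r'. 1 \<le> r' \<and> r' < r \<longrightarrow> (r', c) \<in> D then D
        else let r' = Max {r'. 1 \<le> r' \<and> r' < r \<and> (r', c) \<notin> D} in
          insert (r', c) (D - {(r, c)}))"

definition kohnert_step :: "cell set rel" where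
  "kohnert_step = {(D, kohnert_move r D) | D r. 1 \<le> r}"

definition KD :: "cell set \<Rightarrow> cell set set" where
  "KD D\<^sub>0 = {D. (D\<^sub>0, D) \<in> kohnert_step\<^sup>*}"

text \<open>The order of the Kohnert poset on \<open>KD D\<^sub>0\<close>: a pair \<open>(D\<^sub>2, D\<^sub>1)\<close> means that
  \<open>D\<^sub>2\<close> lies below \<open>D\<^sub>1\<close>.\<close>

definition kohnert_order :: "cell set \<Rightarrow> cell set rel" where
  "kohnert_order D\<^sub>0 =
     {(D\<^sub>2, D\<^sub>1). D\<^sub>1 \<in> KD D\<^sub>0 \<and> D\<^sub>2 \<in> KD D\<^sub>0 \<and> (D\<^sub>1, D\<^sub>2) \<in> kohnert_step\<^sup>*}"

definition minimal_element :: "'a set \<Rightarrow> 'a rel \<Rightarrow> 'a \<Rightarrow> bool" where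
  "minimal_element P le x \<longleftrightarrow> x \<in> P \<and> (\<forall>y\<in>P. (y, x) \<in> le \<longrightarrow> y = x)"

definition maximal_element :: "'a set \<Rightarrow> 'a rel \<Rightarrow> 'a \<Rightarrow> bool" where
  "maximal_element P le x \<longleftrightarrow> x \<in> P \<and> (\<forall>y\<in>P. (x, y) \<in> le \<longrightarrow> y = x)"

text \<open>Meant for finite posets; that the Kohnert posets of diagrams are finite posets is
  proved in \<open>kohnert_poset_finite_poset\<close> below.\<close>

definition bounded_poset :: "'a set \<Rightarrow> 'a rel \<Rightarrow> bool" where
  "bounded_poset P le \<longleftrightarrow> (\<exists>!x. minimal_element P le x) \<and> (\<exists>!x. maximal_element P le x)"

text \<open>The weak composition \<open>(a\<^sub>1, \<dots>, a\<^sub>n)\<close> is a list of length \<open>n\<close>; list positions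
  start at 0.\<close>

definition key_diagram :: "nat list \<Rightarrow> cell set" where
  "key_diagram a = (\<Union>i\<in>{1..length a}. {(i, j) | j. 1 \<le> j \<and> j \<le> a ! (i - 1)})"

lemma is_diagram_key_diagram: "is_diagram (key_diagram a)"
proof -
  have "key_diagram a = (\<Union>i\<in>{1..length a}. Pair i ` {1..a ! (i - 1)})"
    unfolding key_diagram_def by auto
  then have "finite (key_diagram a)" by simp
  then show ?thesis
    unfolding is_diagram_def key_diagram_def by auto
qed

lemma kohnert_move_cases:
  assumes "is_diagram D"
  obtains "kohnert_move r D = D"
  | c r' where "(r, c) \<in> D" "1 \<le> r'" "r' < r" "(r', c) \<notin> D"
      "kohnert_move r D = insert (r', c) (D - {(r, c)})"
proof (cases "kohnert_move r D = D")
  case True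
  then show ?thesis using that(1) by blast
next
  case False
  define C where "C = {c. (r, c) \<in> D}"
  define c where "c = Max C"
  define R where "R = {r'. 1 \<le> r' \<and> r' < r \<and> (r', c) \<notin> D}"
  have "C \<noteq> {}"
    using False unfolding kohnert_move_def C_def by presburger
  moreover have blocked: "\<not> (\<forall>r'. 1 \<le> r' \<and> r' < r \<longrightarrow> (r', c) \<in> D)"
    using False unfolding kohnert_move_def c_def C_def Let_def by presburger
  ultimately have eq: "kohnert_move r D = insert (Max R, c) (D - {(r, c)})"
    unfolding kohnert_move_def Let_def R_def c_def C_def by (simp only: if_False)
  have "C \<subseteq> snd ` D" unfolding C_def by force
  then have "finite C" using assms unfolding is_diagram_def by (meson finite_imageI finite_subset)
  then have "c \<in> C" using \<open>C \<noteq> {}\<close> unfolding c_def by (rule Max_in)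
  have "finite R" unfolding R_def by simp
  moreover have "R \<noteq> {}" using blocked unfolding R_def by auto
  ultimately have "Max R \<in> R" by (rule Max_in)
  then show ?thesis using that(2)[of c "Max R"] eq \<open>c \<in> C\<close> unfolding R_def C_def by auto
qed

lemma kohnert_step_props:
  assumes "is_diagram D" "(D, E) \<in> kohnert_step"
  shows "is_diagram E" "snd ` E \<subseteq> snd ` D"
    "\<forall>(r, c) \<in> E. \<exists>(r', c') \<in> D. r \<le> r'"
    "E = D \<or> sum fst E < sum fst D"
proof -
  obtain r where E: "E = kohnert_move r D" using assms(2) unfolding kohnert_step_def by blast
  have fin: "finite D" using assms(1) unfolding is_diagram_def by blast
  have "is_diagram E \<and> snd ` E \<subseteq> snd ` D \<and> (\<forall>(r, c) \<in> E. \<exists>(r', c') \<in> D. r \<le> r')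
    \<and> (E = D \<or> sum fst E < sum fst D)"
  proof (rule kohnert_move_cases[OF assms(1), of r])
    assume "kohnert_move r D = D"
    then show ?thesis using E assms(1) by auto
  next
    fix c r' assume *: "(r, c) \<in> D" "1 \<le> r'" "r' < r" "(r', c) \<notin> D"
      "kohnert_move r D = insert (r', c) (D - {(r, c)})"
    have E': "E = insert (r', c) (D - {(r, c)})" using E *(5) by simp
    have pos: "\<forall>(x, y) \<in> D. 1 \<le> x \<and> 1 \<le> y" using assms(1) unfolding is_diagram_def by blast
    then have "1 \<le> c" using *(1) by blast
    then have "is_diagram E"
      unfolding is_diagram_def E' using fin *(2) pos by simp
    moreover have "snd ` E \<subseteq> snd ` D" using *(1) unfolding E' by force
    moreover have "\<forall>(r, c) \<in> E. \<exists>(r', c') \<in> D. r \<le> r'"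
    proof clarify
      fix x y assume "(x, y) \<in> E"
      then consider "(x, y) \<in> D" | "x = r'" unfolding E' by auto
      then show "\<exists>(r', c') \<in> D. x \<le> r'"
      proof cases
        case 1
        then show ?thesis by blast
      next
        case 2
        then have "x \<le> r" using *(3) by simp
        then show ?thesis using *(1) by blast
      qed
    qed
    moreover have "sum fst E < sum fst D"
    proof -
      have "sum fst E = r' + sum fst (D - {(r, c)})"
        using *(4) fin unfolding E' by simp
      moreover have "sum fst D = r + sum fst (D - {(r, c)})"
        using sum.remove[OF fin *(1), of fst] by simp
      ultimately show ?thesis using *(3) by simp
    qed
    ultimately show ?thesis by blast
  qed
  then show "is_diagram E" "snd ` E \<subseteq> snd ` D" "\<forall>(r, c) \<in> E. \<exists>(r', c') \<in> D. r \<le> r'"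
    "E = D \<or> sum fst E < sum fst D" by blast+
qed

lemma kohnert_steps_props:
  assumes "(D, E) \<in> kohnert_step\<^sup>*" "is_diagram D"
  shows "is_diagram E \<and> snd ` E \<subseteq> snd ` D \<and> (\<forall>(r, c) \<in> E. \<exists>(r', c') \<in> D. r \<le> r')
    \<and> (E = D \<or> sum fst E < sum fst D)"
  using assms(1)
proof (induction rule: rtrancl_induct)
  case base
  then show ?case using assms(2) by auto
next
  case (step E F)
  note p = kohnert_step_props[OF conjunct1[OF step.IH] step.hyps(2)]
  have "\<forall>(r, c) \<in> F. \<exists>(r', c') \<in> D. r \<le> r'"
  proof clarify
    fix r c assume "(r, c) \<in> F"
    then obtain s d where "(s, d) \<in> E" "r \<le> s" using p(3) by blast
    moreover from this obtain t e where "(t, e) \<in> D" "s \<le> t" using step.IH by blast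
    ultimately have "(t, e) \<in> D" "r \<le> t" by simp_all
    then show "\<exists>(r', c') \<in> D. r \<le> r'" by blast
  qed
  moreover have "snd ` F \<subseteq> snd ` D" using p(2) step.IH by blast
  moreover have "F = D \<or> sum fst F < sum fst D" using p(4) step.IH by auto
  ultimately show ?case using p(1) by blast
qed

lemma kohnert_poset_finite_poset:
  assumes "is_diagram D\<^sub>0"
  shows "finite (KD D\<^sub>0)" "partial_order_on (KD D\<^sub>0) (kohnert_order D\<^sub>0)"
proof -
  have fin: "finite D\<^sub>0" using assms unfolding is_diagram_def by blast
  have "KD D\<^sub>0 \<subseteq> Pow ({..Max (fst ` D\<^sub>0)} \<times> snd ` D\<^sub>0)"
  proof clarify
    fix E r c assume "E \<in> KD D\<^sub>0" and rc: "(r, c) \<in> E"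
    then have p: "snd ` E \<subseteq> snd ` D\<^sub>0" "\<forall>(r, c) \<in> E. \<exists>(r', c') \<in> D\<^sub>0. r \<le> r'"
      using kohnert_steps_props[OF _ assms] unfolding KD_def by auto
    obtain r' c' where "(r', c') \<in> D\<^sub>0" "r \<le> r'" using p(2) rc by blast
    moreover from this have "r' \<le> Max (fst ` D\<^sub>0)" using fin by (force intro: Max_ge)
    moreover have "c \<in> snd ` D\<^sub>0" using p(1) rc by force
    ultimately show "r \<in> {..Max (fst ` D\<^sub>0)} \<and> c \<in> snd ` D\<^sub>0" by simp
  qed
  then show "finite (KD D\<^sub>0)" using fin by (auto intro: finite_subset)
  have "antisym (kohnert_order D\<^sub>0)"
  proof (rule antisymI)
    fix D E assume *: "(D, E) \<in> kohnert_order D\<^sub>0" "(E, D) \<in> kohnert_order D\<^sub>0"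
    then have "is_diagram D" "is_diagram E"
      using kohnert_steps_props[OF _ assms] unfolding kohnert_order_def KD_def by auto
    then show "D = E"
      using * kohnert_steps_props[of D E] kohnert_steps_props[of E D]
      unfolding kohnert_order_def by auto
  qed
  then show "partial_order_on (KD D\<^sub>0) (kohnert_order D\<^sub>0)"
    unfolding partial_order_on_def preorder_on_def
    by (auto simp: kohnert_order_def refl_on_def trans_def)
qed

end

theory Submission
  imports Defs
begin

text \<open>The maximal element is the key diagram itself. For the minimal one, let \<open>N c t\<close> be the
  number of cells of column \<open>c\<close> in rows at least \<open>t\<close>. In a key diagram \<open>N c t\<close> is weakly
  decreasing in \<open>c\<close>, and Kohnert moves preserve this. If a diagram with this property is fixed by
  all moves and the top cell of some column \<open>c\<close>, in row \<open>r\<close>, lies above a hole, then the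
  rightmost cell of row \<open>r\<close> lies in a column \<open>c' > c\<close> that contains rows \<open>1, \<dots>, r\<close>, whereas
  column \<open>c\<close> has fewer than \<open>r\<close> cells, a contradiction. So all columns are bottom-justified, and
  the diagram is determined by its column sizes, which moves do not change.\<close>

section \<open>Columns of a diagram and the effect of one move\<close>

definition column :: "cell set \<Rightarrow> nat \<Rightarrow> nat set" where
  "column D c = {r. (r, c) \<in> D}"

lemma finite_column: "is_diagram D \<Longrightarrow> finite (column D c)"
  unfolding is_diagram_def column_def
  by (rule finite_subset[of _ "fst ` D"]) force+

lemma rightmost_cell:
  assumes "is_diagram D" "(r, c) \<in> D"
  obtains c' where "c \<le> c'" "(r, c') \<in> D" "\<And>d. (r, d) \<in> D \<Longrightarrow> d \<le> c'"
proof -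
  have "{d. (r, d) \<in> D} \<subseteq> snd ` D" by force
  then have fin: "finite {d. (r, d) \<in> D}"
    using assms(1) unfolding is_diagram_def by (meson finite_imageI finite_subset)
  show ?thesis
    using that[of "Max {d. (r, d) \<in> D}"] Max_ge[OF fin] Max_in[OF fin] assms(2) by blast
qed

text \<open>The landing row is the highest hole below the cell, so the rows strictly between it and
  \<open>r\<close> are occupied in column \<open>c\<close>. This yields the third-from-last and last
  conclusions their common witness \<open>r'\<close>.\<close>

lemma kohnert_move_eq:
  assumes "(r, c) \<in> D" "\<And>d. (r, d) \<in> D \<Longrightarrow> d \<le> c"
    and "1 \<le> s" "s < r" "(s, c) \<notin> D"
  obtains r' where "1 \<le> r'" "r' < r" "(r', c) \<notin> D" "\<And>t. r' < t \<Longrightarrow> t < r \<Longrightarrow> (t, c) \<in> D"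
    "kohnert_move r D = insert (r', c) (D - {(r, c)})"
proof -
  define R where "R = {r'. 1 \<le> r' \<and> r' < r \<and> (r', c) \<notin> D}"
  have "{d. (r, d) \<in> D} \<subseteq> {..c}" using assms(2) by auto
  then have "finite {d. (r, d) \<in> D}" by (rule finite_subset) simp
  then have "Max {d. (r, d) \<in> D} = c"
    using assms(1,2) by (intro Max_eqI) auto
  moreover have "{d. (r, d) \<in> D} \<noteq> {}" using assms(1) by blast
  moreover have "\<not> (\<forall>r'. 1 \<le> r' \<and> r' < r \<longrightarrow> (r', c) \<in> D)" using assms(3-5) by blast
  ultimately have eq: "kohnert_move r D = insert (Max R, c) (D - {(r, c)})"
    unfolding kohnert_move_def Let_def R_def by (simp only: if_False)
  have fin: "finite R" unfolding R_def by simp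
  have "s \<in> R" using assms(3-5) unfolding R_def by simp
  then have max: "Max R \<in> R" using fin by (intro Max_in) auto
  have "(t, c) \<in> D" if "Max R < t" "t < r" for t
  proof (rule ccontr)
    assume "(t, c) \<notin> D"
    then have "t \<in> R" using that unfolding R_def by simp
    then show False using Max_ge[OF fin, of t] that(1) by simp
  qed
  then show ?thesis using that[of "Max R"] max eq unfolding R_def by blast
qed

text \<open>Refines \<open>kohnert_move_cases\<close> by two facts on which invariance of column
  domination rests: the moved cell is the last one of its row, and every position it jumps over is
  occupied.\<close>

lemma kohnert_move_rightmost_cases:
  assumes "is_diagram D"
  obtains "kohnert_move r D = D"
  | c r' where "(r, c) \<in> D" "\<And>d. (r, d) \<in> D \<Longrightarrow> d \<le> c" "1 \<le> r'" "r' < r" "(r', c) \<notin> D"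
      "\<And>t. r' < t \<Longrightarrow> t < r \<Longrightarrow> (t, c) \<in> D"
      "kohnert_move r D = insert (r', c) (D - {(r, c)})"
proof (cases "\<exists>c s. (r, c) \<in> D \<and> (\<forall>d. (r, d) \<in> D \<longrightarrow> d \<le> c) \<and> 1 \<le> s \<and> s < r \<and> (s, c) \<notin> D")
  case True
  then obtain c s where c: "(r, c) \<in> D" "\<And>d. (r, d) \<in> D \<Longrightarrow> d \<le> c"
    and s: "1 \<le> s" "s < r" "(s, c) \<notin> D" by blast
  show ?thesis
  proof (rule kohnert_move_eq[OF c s])
    fix q
    assume q: "1 \<le> q" "q < r" "(q, c) \<notin> D" "\<And>t. q < t \<Longrightarrow> t < r \<Longrightarrow> (t, c) \<in> D"
      "kohnert_move r D = insert (q, c) (D - {(r, c)})"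
    show ?thesis by (rule that(2)[OF c q])
  qed
next
  case False
  have "kohnert_move r D = D"
  proof (cases "{d. (r, d) \<in> D} = {}")
    case True
    then show ?thesis unfolding kohnert_move_def by simp
  next
    case ne: False
    then obtain d where "(r, d) \<in> D" by blast
    then obtain c where c: "(r, c) \<in> D" "\<And>d. (r, d) \<in> D \<Longrightarrow> d \<le> c"
      using rightmost_cell[OF assms] by metis
    have "finite {d. (r, d) \<in> D}"
      by (rule finite_subset[of _ "{..c}"]) (use c(2) in auto)
    then have "Max {d. (r, d) \<in> D} = c" using c by (intro Max_eqI) auto
    moreover have "\<forall>r'. 1 \<le> r' \<and> r' < r \<longrightarrow> (r', c) \<in> D" using False c by blast
    ultimately show ?thesis unfolding kohnert_move_def Let_def by simp
  qed
  then show ?thesis by (rule that(1))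
qed

section \<open>Domination between columns as an invariant of moves\<close>

text \<open>The bound \<open>1 \<le> c\<close> excludes column 0, which is empty in every diagram
  and could not dominate a nonempty column.\<close>

definition columns_dominated :: "cell set \<Rightarrow> bool" where
  "columns_dominated D \<longleftrightarrow> (\<forall>c c' t. 1 \<le> c \<longrightarrow> c \<le> c' \<longrightarrow>
     card (column D c' \<inter> {t..}) \<le> card (column D c \<inter> {t..}))"

text \<open>Rows of a key diagram are left-justified, so each column contains every column to its
  right.\<close>

lemma columns_dominated_key_diagram: "columns_dominated (key_diagram a)"
proof -
  have "column (key_diagram a) c' \<inter> {t..} \<subseteq> column (key_diagram a) c \<inter> {t..}"
    if "1 \<le> c" "c \<le> c'" for c c' t
    using that unfolding column_def key_diagram_def by auto
  then show ?thesis
    unfolding columns_dominated_def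
    using finite_column[OF is_diagram_key_diagram] by (meson card_mono finite_Int)
qed

text \<open>Lowering \<open>r\<close> to \<open>q\<close> crosses the threshold \<open>t\<close>
  exactly when \<open>q < t \<le> r\<close>. Then \<open>r\<close> itself was counted, so the
  natural subtraction does not truncate.\<close>

lemma card_insert_remove_lower:
  fixes S :: "nat set"
  assumes "finite S" "r \<in> S" "q \<notin> S" "q < r"
  shows "card (insert q (S - {r}) \<inter> {t..}) =
    card (S \<inter> {t..}) - (if q < t \<and> t \<le> r then 1 else 0)"
proof -
  consider "t \<le> q" | "q < t" "t \<le> r" | "r < t" by linarith
  then show ?thesis
  proof cases
    case 1
    then have "insert q (S - {r}) \<inter> {t..} = insert q (S \<inter> {t..} - {r})" by auto
    moreover have "card (S \<inter> {t..}) = Suc (card (S \<inter> {t..} - {r}))"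
      using assms 1 by (intro card.remove) auto
    ultimately show ?thesis using assms 1 by simp
  next
    case 2
    then have "insert q (S - {r}) \<inter> {t..} = S \<inter> {t..} - {r}" by auto
    then show ?thesis using assms 2 by (simp add: card_Diff_singleton)
  next
    case 3
    then have "insert q (S - {r}) \<inter> {t..} = S \<inter> {t..}" using assms by auto
    then show ?thesis using 3 by simp
  qed
qed

text \<open>Only the counts of the moved column \<open>c\<close> change, and they only drop. Hence
  the sole comparisons at risk are those of \<open>c\<close> with columns to its right, at
  thresholds where one cell is lost; there the old inequality is strict.\<close>

lemma columns_dominated_kohnert_step:
  assumes "is_diagram D" "columns_dominated D" "(D, E) \<in> kohnert_step"
  shows "columns_dominated E \<and> (\<forall>c. card (column E c) = card (column D c))"
proof -
  obtain r where E: "E = kohnert_move r D" using assms(3) unfolding kohnert_step_def by blast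
  show ?thesis
  proof (rule kohnert_move_rightmost_cases[OF assms(1), of r])
    assume "kohnert_move r D = D"
    then show ?thesis using E assms(2) by simp
  next
    fix c q
    assume r: "(r, c) \<in> D" "\<And>d. (r, d) \<in> D \<Longrightarrow> d \<le> c" and q: "1 \<le> q" "q < r" "(q, c) \<notin> D"
      and filled: "\<And>t. q < t \<Longrightarrow> t < r \<Longrightarrow> (t, c) \<in> D"
      and mv: "kohnert_move r D = insert (q, c) (D - {(r, c)})"
    have same: "column E d = column D d" if "d \<noteq> c" for d
      using that unfolding E mv column_def by auto
    have moved: "column E c = insert q (column D c - {r})"
      unfolding E mv column_def by auto
    have card_moved: "card (column E c \<inter> {t..}) =
        card (column D c \<inter> {t..}) - (if q < t \<and> t \<le> r then 1 else 0)" for t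
      unfolding moved using r(1) q(2,3) finite_column[OF assms(1), of c]
      by (intro card_insert_remove_lower) (simp_all add: column_def)
    have dom: "card (column D d' \<inter> {t..}) \<le> card (column D d \<inter> {t..})"
      if "1 \<le> d" "d \<le> d'" for d d' t
      using assms(2) that unfolding columns_dominated_def by blast
    \<comment> \<open>Between \<open>t\<close> and \<open>r\<close>, column \<open>c\<close> is
      full, while column \<open>d\<close> misses row \<open>r\<close> because \<open>(r, c)\<close>
      is the last cell of its row. Above row \<open>r\<close>, domination at threshold
      \<open>Suc r\<close> applies, so a surplus of at least one remains.\<close>
    have strict: "card (column D d \<inter> {t..}) < card (column D c \<inter> {t..})"
      if t: "q < t" "t \<le> r" and d: "1 \<le> c" "c < d" for t d
    proof -
      have "column D d \<inter> {t..} \<subseteq> {t..<r} \<union> column D d \<inter> {Suc r..}"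
      proof
        fix x assume x: "x \<in> column D d \<inter> {t..}"
        then have "x \<noteq> r" using r(2)[of d] d(2) unfolding column_def by auto
        then show "x \<in> {t..<r} \<union> column D d \<inter> {Suc r..}" using x by auto
      qed
      then have "card (column D d \<inter> {t..}) \<le> card ({t..<r} \<union> column D d \<inter> {Suc r..})"
        using finite_column[OF assms(1)] by (intro card_mono) auto
      also have "\<dots> \<le> card {t..<r} + card (column D d \<inter> {Suc r..})" by (rule card_Un_le)
      also have "\<dots> < card {t..r} + card (column D c \<inter> {Suc r..})"
        using dom[of c d "Suc r"] t d by simp
      also have "\<dots> = card ({t..r} \<union> column D c \<inter> {Suc r..})"
        using finite_column[OF assms(1)] by (intro card_Un_disjoint[symmetric]) auto
      also have "{t..r} \<union> column D c \<inter> {Suc r..} = column D c \<inter> {t..}"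
      proof -
        have "x \<in> column D c" if "t \<le> x" "x \<le> r" for x
          using filled[of x] r(1) t that unfolding column_def by (cases "x = r") auto
        then show ?thesis using t by (auto simp: not_less_eq_eq)
      qed
      finally show ?thesis .
    qed
    have "card (column E d' \<inter> {t..}) \<le> card (column E d \<inter> {t..})"
      if d: "1 \<le> d" "d \<le> d'" for d d' t
    proof (cases "d = c")
      case True
      show ?thesis
      proof (cases "d' = c")
        case False
        then show ?thesis
          using d True strict[of t d'] dom[of c d' t] by (auto simp: same card_moved)
      qed (simp add: True)
    next
      case False
      then show ?thesis
        using dom[OF d, of t] by (cases "d' = c") (auto simp: same card_moved)
    qed
    then have "columns_dominated E" unfolding columns_dominated_def by blast
    moreover have "card (column E d) = card (column D d)" for d
      \<comment> \<open>At threshold 0 the count is the size of the whole column, and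
        \<open>q < 0\<close> is false, so nothing is lost.\<close>
      using card_moved[of 0] by (cases "d = c") (simp_all add: same)
    ultimately show ?thesis by blast
  qed
qed

lemma columns_dominated_kohnert_steps:
  assumes "(D, E) \<in> kohnert_step\<^sup>*" "is_diagram D" "columns_dominated D"
  shows "is_diagram E \<and> columns_dominated E \<and> (\<forall>c. card (column E c) = card (column D c))"
  using assms(1)
proof (induction rule: rtrancl_induct)
  case base
  then show ?case using assms(2,3) by blast
next
  case (step E F)
  then show ?case
    using kohnert_step_props(1)[of E F] columns_dominated_kohnert_step[of E F] by auto
qed

text \<open>The contradiction from the overview is run directly: with \<open>r\<close> the top row
  of column \<open>c\<close>, domination at threshold 0 gives column \<open>c\<close> at least
  \<open>r\<close> cells, and they all lie in \<open>{1..r}\<close>.\<close>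

lemma column_bottom_justified:
  assumes "is_diagram D" "columns_dominated D" "\<And>r. 1 \<le> r \<Longrightarrow> kohnert_move r D = D"
  shows "column D c = {1..card (column D c)}"
proof (cases "column D c = {}")
  case False
  define r where "r = Max (column D c)"
  have fin: "finite (column D d)" for d using assms(1) by (rule finite_column)
  have pos: "1 \<le> x \<and> 1 \<le> y" if "(x, y) \<in> D" for x y
    using assms(1) that unfolding is_diagram_def by blast
  have r: "(r, c) \<in> D" using Max_in[OF fin False] unfolding r_def column_def by blast
  have sub: "column D c \<subseteq> {1..r}"
    using Max_ge[OF fin] pos unfolding r_def column_def by auto
  obtain c' where c': "c \<le> c'" "(r, c') \<in> D" "\<And>d. (r, d) \<in> D \<Longrightarrow> d \<le> c'"
    using rightmost_cell[OF assms(1) r] by blast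
  have "(s, c') \<in> D" if "1 \<le> s" "s < r" for s
  \<comment> \<open>A hole below the rightmost cell of row \<open>r\<close> would make the move
    vacate \<open>(r, c')\<close>, although \<open>D\<close> is fixed by all moves.\<close>
  proof (rule ccontr)
    assume "(s, c') \<notin> D"
    from kohnert_move_eq[OF c'(2,3) that this] obtain q where
      "q < r" "kohnert_move r D = insert (q, c') (D - {(r, c')})" by metis
    then have "(r, c') \<notin> kohnert_move r D" by simp
    then show False using c'(2) assms(3)[of r] pos[OF r] by simp
  qed
  then have "{1..r} \<subseteq> column D c'" using c'(2) unfolding column_def by (auto simp: le_less)
  then have "r \<le> card (column D c')" using card_mono[OF fin, of "{1..r}" c'] by simp
  also have "\<dots> = card (column D c' \<inter> {0..})" by simp
  also have "\<dots> \<le> card (column D c \<inter> {0..})"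
    using assms(2) c'(1) pos[OF r] unfolding columns_dominated_def by blast
  also have "\<dots> = card (column D c)" by simp
  finally have "r \<le> card (column D c)" .
  then have "column D c = {1..r}" by (intro card_seteq sub) simp_all
  then show ?thesis by simp
qed simp

section \<open>Minimal and maximal elements\<close>

lemma minimal_element_kohnert_move:
  assumes "minimal_element (KD D\<^sub>0) (kohnert_order D\<^sub>0) D" "1 \<le> r"
  shows "kohnert_move r D = D"
proof -
  have D: "D \<in> KD D\<^sub>0" and min: "\<And>E. E \<in> KD D\<^sub>0 \<Longrightarrow> (E, D) \<in> kohnert_order D\<^sub>0 \<Longrightarrow> E = D"
    using assms(1) unfolding minimal_element_def by blast+
  have step: "(D, kohnert_move r D) \<in> kohnert_step" using assms(2) unfolding kohnert_step_def by blast
  then have "kohnert_move r D \<in> KD D\<^sub>0" using D unfolding KD_def by auto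
  then show ?thesis using min[of "kohnert_move r D"] step D unfolding kohnert_order_def by auto
qed

text \<open>Every effective move lowers the sum of the row indices, so a reachable diagram with
  least sum is minimal.\<close>

lemma ex_minimal_element_kohnert:
  assumes "is_diagram D\<^sub>0"
  shows "\<exists>D. minimal_element (KD D\<^sub>0) (kohnert_order D\<^sub>0) D"
proof -
  have "D\<^sub>0 \<in> KD D\<^sub>0" unfolding KD_def by simp
  then obtain D where D: "D \<in> KD D\<^sub>0" "\<And>E. E \<in> KD D\<^sub>0 \<Longrightarrow> sum fst D \<le> sum fst E"
    using ex_has_least_nat[of "\<lambda>D. D \<in> KD D\<^sub>0" D\<^sub>0 "sum fst"] by blast
  have "is_diagram D" using D(1) kohnert_steps_props[OF _ assms] unfolding KD_def by blast
  then have "E = D" if "(E, D) \<in> kohnert_order D\<^sub>0" for E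
    using that D(2)[of E] kohnert_steps_props[of D E] unfolding kohnert_order_def by auto
  then show ?thesis using D(1) unfolding minimal_element_def by blast
qed

text \<open>Everything is reachable from the initial diagram, which is therefore the greatest
  element; antisymmetry then makes it maximal.\<close>

lemma ex1_maximal_element_kohnert:
  assumes "is_diagram D\<^sub>0"
  shows "\<exists>!D. maximal_element (KD D\<^sub>0) (kohnert_order D\<^sub>0) D"
proof (rule ex1I[of _ D\<^sub>0])
  have D\<^sub>0: "D\<^sub>0 \<in> KD D\<^sub>0" unfolding KD_def by simp
  have top: "(D, D\<^sub>0) \<in> kohnert_order D\<^sub>0" if "D \<in> KD D\<^sub>0" for D
    using that D\<^sub>0 unfolding kohnert_order_def KD_def by auto
  have "antisym (kohnert_order D\<^sub>0)"
    using kohnert_poset_finite_poset(2)[OF assms] unfolding partial_order_on_def by blast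
  then show "maximal_element (KD D\<^sub>0) (kohnert_order D\<^sub>0) D\<^sub>0"
    unfolding maximal_element_def using D\<^sub>0 top by (auto dest: antisymD)
  show "D = D\<^sub>0" if "maximal_element (KD D\<^sub>0) (kohnert_order D\<^sub>0) D" for D
    using that D\<^sub>0 top unfolding maximal_element_def by blast
qed

lemma minimal_element_kohnert_unique:
  assumes "is_diagram D\<^sub>0" "columns_dominated D\<^sub>0"
    and "minimal_element (KD D\<^sub>0) (kohnert_order D\<^sub>0) D"
    and "minimal_element (KD D\<^sub>0) (kohnert_order D\<^sub>0) E"
  shows "D = E"
proof -
  \<comment> \<open>The right-hand side depends on the initial diagram alone, so any two minimal
    elements agree column by column.\<close>
  have col: "column F c = {1..card (column D\<^sub>0 c)}"
    if F: "minimal_element (KD D\<^sub>0) (kohnert_order D\<^sub>0) F" for F c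
  proof -
    have "(D\<^sub>0, F) \<in> kohnert_step\<^sup>*" using F unfolding minimal_element_def KD_def by blast
    from columns_dominated_kohnert_steps[OF this assms(1,2)]
    show ?thesis using column_bottom_justified[of F c] minimal_element_kohnert_move[OF F] by simp
  qed
  have "column D c = column E c" for c using col assms(3,4) by simp
  then show ?thesis unfolding column_def set_eq_iff by simp
qed

theorem theorem6p1:
  fixes a :: "nat list"
  shows "bounded_poset (KD (key_diagram a)) (kohnert_order (key_diagram a))"
  unfolding bounded_poset_def
  using ex_minimal_element_kohnert[OF is_diagram_key_diagram]
    minimal_element_kohnert_unique[OF is_diagram_key_diagram columns_dominated_key_diagram]
    ex1_maximal_element_kohnert[OF is_diagram_key_diagram]
  by blast

end
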